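(* Let $p>7$ be a prime and let $J$ be a sequence of elements of $Z_p^3$ with $|J|=7p-3$. Suppose there is a fixed integer $c$ such that for every subsequence $I\subset J$ with $|I|=4p-3$ one has $N^{2p}(I)\equiv c \pmod p$. Then $J$ has a subsequence of length $p$ whose sum is $0$ modulo $p$.
   Context: $Z_p=\mathbb{Z}/p\mathbb{Z}$. A sequence in $Z_p^3$ is a finite sequence of elements in which repetitions are allowed and order is irrelevant; $|J|$ denotes its length (counted with multiplicity). A subsequence of $J$ is obtained by choosing a subset of the indices of $J$. For a sequence $I$ in $Z_p^3$ and an integer $k\ge 1$, $N^{kp}(I)$ is the number of subsequences of $I$ of length $kp$ (counted as subsets of the index set) whose sum is $0$ in $Z_p^3$. *)

theory Defs
  imports
    "HOL-Algebra.Elementary_Groups"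
    "HOL-Algebra.FiniteProduct"
    "HOL-Number_Theory.Cong"
    "HOL-Computational_Algebra.Primes"
begin

definition Zp3 :: "nat \<Rightarrow> (int \<times> int \<times> int) monoid" where
  "Zp3 p = integer_mod_group p \<times>\<times> integer_mod_group p \<times>\<times> integer_mod_group p"

text \<open>
  A sequence is a list \<open>J\<close> over the carrier of \<^term>\<open>Zp3 p\<close>. A subsequence of \<open>J\<close> is
  represented by its set \<open>I \<subseteq> {..<length J}\<close> of indices, so its length is \<^term>\<open>card I\<close>,
  and subsequences with equal values at different indices are counted separately.
  The group operation is addition mod \<open>p\<close>, hence \<^const>\<open>finprod\<close> is the sum of
  the terms.
\<close>

definition seq_sum :: "nat \<Rightarrow> (int \<times> int \<times> int) list \<Rightarrow> nat set \<Rightarrow> int \<times> int \<times> int" where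
  "seq_sum p J I = finprod (Zp3 p) (\<lambda>i. J ! i) I"

definition num_zero_sum :: "nat \<Rightarrow> nat \<Rightarrow> (int \<times> int \<times> int) list \<Rightarrow> nat set \<Rightarrow> nat" where
  "num_zero_sum p k J I =
     card {S. S \<subseteq> I \<and> card S = k * p \<and> seq_sum p J S = \<one>\<^bsub>Zp3 p\<^esub>}"

lemma comm_group_Zp3: "comm_group (Zp3 p)"
proof -
  have "group (Zp3 p)"
    by (simp add: Zp3_def DirProd_group)
  then show ?thesis
    by (rule group.group_comm_groupI) (auto simp: Zp3_def add.commute)
qed

lemma seq_sum_eq:
  assumes J: "set J \<subseteq> carrier (Zp3 p)" and I: "I \<subseteq> {..<length J}"
  shows "seq_sum p J I =
    ((\<Sum>i\<in>I. fst (J ! i)) mod int p,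
     (\<Sum>i\<in>I. fst (snd (J ! i))) mod int p,
     (\<Sum>i\<in>I. snd (snd (J ! i))) mod int p)"
proof -
  interpret comm_group "Zp3 p" by (rule comm_group_Zp3)
  have "finite I" using I finite_subset by blast
  then show ?thesis using I
  proof (induction I)
    case empty
    then show ?case by (simp add: seq_sum_def, simp add: Zp3_def)
  next
    case (insert i I)
    have "J ! i \<in> carrier (Zp3 p)" "(\<lambda>i. J ! i) \<in> I \<rightarrow> carrier (Zp3 p)"
      using insert.prems by (auto intro!: subsetD[OF J] nth_mem)
    with insert show ?case
      by (cases "J ! i") (simp add: seq_sum_def, simp add: Zp3_def mod_add_right_eq)
  qed
qed

end

theory Submission
  imports Defs "HOL-Number_Theory.Residues"
begin

text \<open>
  Let \<open>N k I\<close> be the number of zero-sum subsequences of \<open>I\<close> of length \<open>k * p\<close>, and suppose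
  \<open>N 1 J = 0\<close>. The product of the terms \<open>1 - l ^ (p - 1)\<close> over the three coordinate
  sums and the length is a polynomial of degree \<open>4 * (p - 1)\<close> that indicates modulo \<open>p\<close> the
  zero-sum subsequences of length divisible by \<open>p\<close>; its alternating sum over the subsets of a
  larger set vanishes, so \<open>\<Sum>k. (-1) ^ k * N k I\<close> is divisible by \<open>p\<close> whenever
  \<open>card I \<ge> 4 * p - 3\<close>. Averaging this congruence and the hypothesis over the subsets of size
  \<open>b * p - 3\<close> of a set of size \<open>a * p - 3\<close> turns both into linear relations whose
  coefficients are, by Lucas' congruence, small binomial coefficients. For \<open>J\<close> they give
  \<open>N 4 J = 30 * c + 45\<close> and \<open>N 6 J = 5 * c + 10\<close> modulo \<open>p\<close>.

  A zero-sum subsequence \<open>Z\<close> of length \<open>k * p\<close> contains none of length \<open>(k - 1) * p\<close>, by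
  complementation. Dropping three terms of \<open>Z\<close> and using the relations there gives \<open>c = -1\<close> if
  \<open>N 4 J \<noteq> 0\<close>, and \<open>5 * c = -9\<close> if \<open>N 6 J \<noteq> 0\<close>. No value of \<open>c\<close> is
  compatible with all of this.
\<close>

section \<open>Finite differences and polynomial degree\<close>

text \<open>
  The polynomial \<open>f\<close> in the indicator variables of a set has degree at most \<open>d\<close>, expressed by
  the vanishing of its finite differences of order above \<open>d\<close>.
\<close>

definition alt_degree :: "nat \<Rightarrow> ('a set \<Rightarrow> int) \<Rightarrow> bool" where
  "alt_degree d f \<longleftrightarrow>
     (\<forall>A I. finite A \<longrightarrow> finite I \<longrightarrow> A \<inter> I = {} \<longrightarrow> d < card I \<longrightarrow>
        (\<Sum>S\<in>Pow I. (-1) ^ card S * f (A \<union> S)) = 0)"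

lemma alt_degree_const: "alt_degree 0 (\<lambda>_. c)"
  unfolding alt_degree_def
proof (intro allI impI)
  fix A I :: "'a set"
  assume "finite I" "0 < card I"
  \<comment> \<open>The sum expands the product of \<open>1 - 1\<close> over the nonempty set
    \<open>I\<close>.\<close>
  then have "(\<Sum>S\<in>Pow I. (-1) ^ card S) = (0 :: int)"
    using prod_diff_conv_sum[of I "\<lambda>_. 1 :: int" "\<lambda>_. 1"] by (simp add: card_gt_0_iff zero_power)
  then show "(\<Sum>S\<in>Pow I. (-1) ^ card S * c) = 0"
    by (simp flip: sum_distrib_right)
qed

lemma alt_degree_mono: "alt_degree d f \<Longrightarrow> d \<le> e \<Longrightarrow> alt_degree e f"
  unfolding alt_degree_def by (meson le_less_trans)

lemma alt_degree_diff:
  "alt_degree d f \<Longrightarrow> alt_degree d g \<Longrightarrow> alt_degree d (\<lambda>S. f S - g S)"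
  by (simp add: alt_degree_def right_diff_distrib sum_subtractf)

text \<open>The sum over \<open>A \<union> S\<close> is a constant from \<open>A\<close> plus the
  \<open>a i\<close> with \<open>i \<in> S\<close>. The constant leaves a difference of
  \<open>f\<close> over \<open>I\<close>; for each \<open>i\<close>, moving \<open>i\<close> into
  the base set leaves one over \<open>I - {i}\<close>, still of order above
  \<open>d\<close>.\<close>

lemma alt_degree_mult_linear:
  assumes f: "alt_degree d f"
  shows "alt_degree (Suc d) (\<lambda>S. f S * (\<Sum>i\<in>S. a i))"
  unfolding alt_degree_def
proof (intro allI impI)
  fix A I :: "'a set"
  assume A: "finite A" and I: "finite I" and disj: "A \<inter> I = {}" and card: "Suc d < card I"
  have vanish: "(\<Sum>S\<in>{S\<in>Pow I. i \<in> S}. (-1) ^ card S * f (A \<union> S)) = 0" if i: "i \<in> I" for i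
  proof -
    have "(\<Sum>S\<in>{S\<in>Pow I. i \<in> S}. (-1) ^ card S * f (A \<union> S))
        = (\<Sum>S\<in>Pow (I - {i}). (-1) ^ card (insert i S) * f (A \<union> insert i S))"
      by (rule sum.reindex_bij_witness[of _ "insert i" "\<lambda>S. S - {i}"])
        (use i in \<open>auto simp: insert_absorb\<close>)
    also have "\<dots> = - (\<Sum>S\<in>Pow (I - {i}). (-1) ^ card S * f (insert i A \<union> S))"
      unfolding sum_negf[symmetric]
    proof (rule sum.cong)
      fix S assume "S \<in> Pow (I - {i})"
      then have "finite S" "i \<notin> S" using I finite_subset by auto
      then show "(-1) ^ card (insert i S) * f (A \<union> insert i S)
          = - ((-1) ^ card S * f (insert i A \<union> S))" by simp
    qed simp
    also have "(\<Sum>S\<in>Pow (I - {i}). (-1) ^ card S * f (insert i A \<union> S)) = 0"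
    proof (rule f[unfolded alt_degree_def, rule_format])
      show "insert i A \<inter> (I - {i}) = {}" using disj by blast
    qed (use A I card i in auto)
    finally show ?thesis by simp
  qed
  have "(\<Sum>S\<in>Pow I. (-1) ^ card S * (f (A \<union> S) * (\<Sum>i\<in>A \<union> S. a i)))
      = (\<Sum>S\<in>Pow I. (\<Sum>i\<in>A. a i) * ((-1) ^ card S * f (A \<union> S))
          + (\<Sum>i\<in>I. if i \<in> S then a i * ((-1) ^ card S * f (A \<union> S)) else 0))"
  proof (rule sum.cong)
    fix S assume "S \<in> Pow I"
    then have S: "S \<subseteq> I" by simp
    have "(\<Sum>i\<in>A \<union> S. a i) = (\<Sum>i\<in>A. a i) + (\<Sum>i\<in>S. a i)"
      using A I S disj by (intro sum.union_disjoint) (auto intro: finite_subset)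
    moreover have "(\<Sum>i\<in>I. if i \<in> S then a i * ((-1) ^ card S * f (A \<union> S)) else 0)
        = (\<Sum>i\<in>S. a i) * ((-1) ^ card S * f (A \<union> S))"
      using I S by (simp add: sum.inter_restrict[symmetric] Int_absorb1 sum_distrib_right)
    ultimately show "(-1) ^ card S * (f (A \<union> S) * (\<Sum>i\<in>A \<union> S. a i))
        = (\<Sum>i\<in>A. a i) * ((-1) ^ card S * f (A \<union> S))
          + (\<Sum>i\<in>I. if i \<in> S then a i * ((-1) ^ card S * f (A \<union> S)) else 0)"
      by (simp add: algebra_simps)
  qed simp
  also have "\<dots> = (\<Sum>i\<in>A. a i) * (\<Sum>S\<in>Pow I. (-1) ^ card S * f (A \<union> S))
      + (\<Sum>i\<in>I. \<Sum>S\<in>Pow I. if i \<in> S then a i * ((-1) ^ card S * f (A \<union> S)) else 0)"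
    by (simp add: sum.distrib sum_distrib_left sum.swap[of _ I])
  also have "(\<Sum>S\<in>Pow I. (-1) ^ card S * f (A \<union> S)) = 0"
    using f A I disj card by (simp add: alt_degree_def)
  also have "(\<Sum>i\<in>I. \<Sum>S\<in>Pow I. if i \<in> S then a i * ((-1) ^ card S * f (A \<union> S)) else 0)
      = (\<Sum>i\<in>I. a i * (\<Sum>S\<in>{S\<in>Pow I. i \<in> S}. (-1) ^ card S * f (A \<union> S)))"
    unfolding sum_distrib_left sum.inter_filter[OF finite_Pow_iff[THEN iffD2, OF I]]
    by (intro sum.cong refl) simp
  also have "\<dots> = 0" using vanish by simp
  finally show "(\<Sum>S\<in>Pow I. (-1) ^ card S * (f (A \<union> S) * (\<Sum>i\<in>A \<union> S. a i))) = 0" by simp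
qed

lemma alt_degree_mult_linear_power:
  assumes "alt_degree d f"
  shows "alt_degree (d + n) (\<lambda>S. f S * (\<Sum>i\<in>S. a i) ^ n)"
proof (induction n)
  case (Suc n)
  from alt_degree_mult_linear[OF this, of a] show ?case
    by (simp add: mult_ac)
qed (use assms in simp)

text \<open>Splitting \<open>F * (1 - l ^ n)\<close> as \<open>F - F * l ^ n\<close> shows that each
  factor raises the degree bound by \<open>n\<close>.\<close>

lemma alt_degree_prod_indicator:
  assumes "finite K"
  shows "alt_degree (card K * n) (\<lambda>S. \<Prod>k\<in>K. 1 - (\<Sum>i\<in>S. a k i) ^ n)"
  using assms
proof (induction K)
  case empty
  then show ?case by (simp add: alt_degree_const)
next
  case (insert k K)
  let ?f = "\<lambda>S. \<Prod>k\<in>K. 1 - (\<Sum>i\<in>S. a k i) ^ n"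
  have "alt_degree (card K * n + n) (\<lambda>S. ?f S - ?f S * (\<Sum>i\<in>S. a k i) ^ n)"
    by (intro alt_degree_diff alt_degree_mult_linear_power insert.IH
        alt_degree_mono[OF insert.IH]) simp
  with insert.hyps show ?case
    by (simp add: algebra_simps)
qed

section \<open>Fermat indicators modulo \<open>p\<close>\<close>

lemma prod_of_bool:
  assumes "finite K"
  shows "(\<Prod>k\<in>K. of_bool (P k)) = (of_bool (\<forall>k\<in>K. P k) :: int)"
  using assms by induction auto

lemma fermat_indicator:
  assumes "prime p"
  shows "[1 - x ^ (p - 1) = of_bool (int p dvd x)] (mod int p)"
proof (cases "int p dvd x")
  case True
  then have "int p dvd x ^ (p - 1)"
    using prime_gt_1_nat[OF assms] by (intro dvd_power_le[of _ _ 1, simplified]) auto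
  then show ?thesis using True by (simp add: cong_iff_dvd_diff)
next
  case False
  have "[x ^ (p - 1) = 1] (mod int p)"
  proof -
    let ?y = "nat (x mod int p)"
    have y: "int ?y = x mod int p"
      using prime_gt_0_nat[OF assms] by simp
    with False have "\<not> p dvd ?y"
      by (metis dvd_mod_iff dvd_refl int_dvd_int_iff)
    then have "[int ?y ^ (p - 1) = 1] (mod int p)"
      using fermat_theorem[OF assms, of ?y] cong_int_iff[of "?y ^ (p - 1)" 1 p] by simp
    then show ?thesis
      unfolding y by (simp add: cong_def power_mod)
  qed
  with False show ?thesis
    by (simp add: cong_iff_dvd_diff dvd_diff_commute)
qed

section \<open>Zero-sum subsequences and their alternating count\<close>

text \<open>The \<open>k\<close>-th coordinate of the \<open>i\<close>-th term of the sequence is \<open>a k i\<close>.\<close>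

definition zero_sums :: "nat \<Rightarrow> 'k set \<Rightarrow> ('k \<Rightarrow> 'a \<Rightarrow> int) \<Rightarrow> nat \<Rightarrow> 'a set \<Rightarrow> 'a set set" where
  "zero_sums p K a n I = {S. S \<subseteq> I \<and> card S = n \<and> (\<forall>k\<in>K. int p dvd (\<Sum>i\<in>S. a k i))}"

lemma zero_sums_diff:
  assumes "finite Z" "Z \<in> zero_sums p K a n I" "S \<in> zero_sums p K a m Z"
  shows "Z - S \<in> zero_sums p K a (n - m) Z"
proof -
  have "S \<subseteq> Z" "finite S" using assms finite_subset by (auto simp: zero_sums_def)
  then show ?thesis
    using assms by (auto simp: zero_sums_def card_Diff_subset sum_diff)
qed

lemma alternating_zero_sums:
  fixes a :: "'k \<Rightarrow> 'a \<Rightarrow> int"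
  assumes p: "prime p" "odd p" and K: "finite K" and I: "finite I"
    and lower: "Suc (card K) * (p - 1) < card I" and upper: "card I < b * p"
  shows "int p dvd (\<Sum>k<b. (-1) ^ k * int (card (zero_sums p K a (k * p) I)))"
proof -
  let ?Q = "\<lambda>S. p dvd card S \<and> (\<forall>k\<in>K. int p dvd (\<Sum>i\<in>S. a k i))"
  \<comment> \<open>The length becomes one more coordinate, with index \<open>None\<close>, in which
    every term is 1; hence the \<open>Suc (card K)\<close> factors and the bound
    \<open>lower\<close>.\<close>
  let ?a = "\<lambda>k. case k of None \<Rightarrow> (\<lambda>_. 1) | Some k \<Rightarrow> a k"
  let ?K = "insert None (Some ` K)"
  let ?f = "\<lambda>S. \<Prod>k\<in>?K. 1 - (\<Sum>i\<in>S. ?a k i) ^ (p - 1)"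
  have p0: "p > 0" using p(1) prime_gt_0_nat by blast
  have cardK: "card ?K = Suc (card K)"
    using K by (subst card_insert_disjoint) (auto simp: card_image)
  have ind: "[?f S = of_bool (?Q S)] (mod int p)" if "S \<in> Pow I" for S
  proof -
    have "[?f S = (\<Prod>k\<in>?K. of_bool (int p dvd (\<Sum>i\<in>S. ?a k i)))] (mod int p)"
      by (intro cong_prod fermat_indicator p)
    also have "(\<Prod>k\<in>?K. of_bool (int p dvd (\<Sum>i\<in>S. ?a k i)))
        = (of_bool (\<forall>k\<in>?K. int p dvd (\<Sum>i\<in>S. ?a k i)) :: int)"
      by (rule prod_of_bool) (use K in simp)
    also have "(\<forall>k\<in>?K. int p dvd (\<Sum>i\<in>S. ?a k i)) \<longleftrightarrow> ?Q S"
      by simp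
    finally show ?thesis .
  qed
  have "(\<Sum>S\<in>Pow I. (-1) ^ card S * ?f S) = 0"
    using alt_degree_prod_indicator[of ?K "p - 1" ?a, unfolded alt_degree_def cardK,
        rule_format, of "{}" I] K I lower by simp
  moreover have "[(\<Sum>S\<in>Pow I. (-1) ^ card S * ?f S)
      = (\<Sum>S\<in>Pow I. (-1) ^ card S * of_bool (?Q S))] (mod int p)"
    by (intro cong_sum cong_mult ind) auto
  ultimately have "int p dvd (\<Sum>S\<in>Pow I. (-1) ^ card S * of_bool (?Q S))"
    by (simp add: cong_iff_dvd_diff)
  also have "(\<Sum>S\<in>Pow I. (-1) ^ card S * of_bool (?Q S) :: int)
      = (\<Sum>S\<in>{S\<in>Pow I. ?Q S}. (-1) ^ card S)"
    by (subst sum.inter_filter) (use I in \<open>auto intro!: sum.cong simp: of_bool_def\<close>)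
  also have "{S\<in>Pow I. ?Q S} = (\<Union>k<b. zero_sums p K a (k * p) I)"
  proof (intro equalityI subsetI)
    fix S assume S: "S \<in> {S\<in>Pow I. ?Q S}"
    then obtain k where k: "card S = k * p" by (auto simp: dvd_def mult.commute)
    \<comment> \<open>By \<open>upper\<close>, the range \<open>k < b\<close> covers every multiple
      of \<open>p\<close> that can occur as a length.\<close>
    have "card S \<le> card I"
      using S I by (intro card_mono) auto
    with upper k have "k * p < b * p"
      by linarith
    then show "S \<in> (\<Union>k<b. zero_sums p K a (k * p) I)"
      using S k by (auto simp: zero_sums_def)
  qed (auto simp: zero_sums_def)
  also have "(\<Sum>S\<in>(\<Union>k<b. zero_sums p K a (k * p) I). (-1 :: int) ^ card S)
      = (\<Sum>k<b. \<Sum>S\<in>zero_sums p K a (k * p) I. (-1) ^ card S)"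
    using I p0 by (intro sum.UNION_disjoint) (auto simp: zero_sums_def)
  also have "\<dots> = (\<Sum>k<b. (-1) ^ k * int (card (zero_sums p K a (k * p) I)))"
    \<comment> \<open>As \<open>p\<close> is odd, \<open>(-1) ^ (k * p) = (-1) ^ k\<close>.\<close>
    using p(2) by (intro sum.cong) (auto simp: zero_sums_def power_mult uminus_power_if)
  finally show ?thesis .
qed

section \<open>Averaging over subsets of fixed size\<close>

text \<open>Double counting of pairs \<open>S \<subseteq> L\<close>: each \<open>S\<close> is
  extended to an \<open>L\<close> by choosing \<open>m - n\<close> further indices outside
  \<open>S\<close>.\<close>

lemma sum_card_zero_sums_subsets:
  assumes I: "finite I" and m: "n \<le> m"
  shows "(\<Sum>L\<in>{L. L \<subseteq> I \<and> card L = m}. card (zero_sums p K a n L))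
    = ((card I - n) choose (m - n)) * card (zero_sums p K a n I)"
proof -
  let ?\<L> = "{L. L \<subseteq> I \<and> card L = m}"
  have fin: "finite ?\<L>" "finite (zero_sums p K a n I)"
    using I by (auto simp: zero_sums_def)
  have "(\<Sum>L\<in>?\<L>. card (zero_sums p K a n L)) = (\<Sum>L\<in>?\<L>. card {S\<in>zero_sums p K a n I. S \<subseteq> L})"
    by (intro sum.cong arg_cong[where f = card]) (auto simp: zero_sums_def)
  also have "\<dots> = (\<Sum>S\<in>zero_sums p K a n I. card {L\<in>?\<L>. S \<subseteq> L})"
    by (rule sum_multicount_gen) (use fin in auto)
  also have "\<dots> = (\<Sum>S\<in>zero_sums p K a n I. (card I - n) choose (m - n))"
  proof (rule sum.cong)
    fix S assume S: "S \<in> zero_sums p K a n I"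
    then have S': "S \<subseteq> I" "card S = n" "finite S"
      using I finite_subset by (auto simp: zero_sums_def)
    have "card {L\<in>?\<L>. S \<subseteq> L} = card {T. T \<subseteq> I - S \<and> card T = m - n}"
    proof (rule bij_betw_same_card[of "\<lambda>L. L - S"],
        rule bij_betw_byWitness[where f' = "\<lambda>T. T \<union> S"])
      show "(\<lambda>L. L - S) ` {L\<in>?\<L>. S \<subseteq> L} \<subseteq> {T. T \<subseteq> I - S \<and> card T = m - n}"
        using S' by (auto simp: card_Diff_subset)
      show "(\<lambda>T. T \<union> S) ` {T. T \<subseteq> I - S \<and> card T = m - n} \<subseteq> {L\<in>?\<L>. S \<subseteq> L}"
      proof safe
        fix T assume T: "T \<subseteq> I - S" "card T = m - n"
        then have "card (T \<union> S) = card T + card S"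
          using I S' by (intro card_Un_disjoint) (auto intro: finite_subset)
        with T S' m show "card (T \<union> S) = m" by simp
      qed (use S' in auto)
    qed auto
    also have "\<dots> = card (I - S) choose (m - n)"
      using I by (intro n_subsets) simp
    also have "card (I - S) = card I - n"
      using S' by (simp add: card_Diff_subset)
    finally show "card {L\<in>?\<L>. S \<subseteq> L} = (card I - n) choose (m - n)" .
  qed simp
  finally show ?thesis by simp
qed

section \<open>Binomial coefficients modulo \<open>p\<close>\<close>

text \<open>In Vandermonde's expansion, \<open>p\<close> divides \<open>p choose i\<close> for 0 < i
  < p and larger \<open>i\<close> give zero, so only \<open>i = 0\<close> and \<open>i = p\<close>
  survive.\<close>

lemma binomial_add_prime_cong:
  assumes "prime p"
  shows "[(m + p) choose j = (m choose j) + (if p \<le> j then m choose (j - p) else 0)] (mod p)"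
proof -
  let ?g = "\<lambda>i. (p choose i) * (m choose (j - i))"
  have p0: "p > 0" using assms prime_gt_0_nat by blast
  have "[(\<Sum>i\<le>j. ?g i) = (\<Sum>i\<le>j. if i = 0 \<or> i = p then m choose (j - i) else 0)] (mod p)"
  proof (rule cong_sum)
    fix i assume "i \<in> {..j}"
    show "[?g i = (if i = 0 \<or> i = p then m choose (j - i) else 0)] (mod p)"
    proof (cases "i = 0 \<or> i \<ge> p")
      case True
      then show ?thesis by (auto simp: binomial_eq_0)
    next
      case False
      then have "p dvd (p choose i)"
        using assms by (intro dvd_choose_prime) auto
      with False show ?thesis by (simp add: cong_0_iff)
    qed
  qed
  also have "(\<Sum>i\<le>j. if i = 0 \<or> i = p then m choose (j - i) else 0)
      = (\<Sum>i\<le>j. (if i = 0 then m choose j else 0) + (if i = p then m choose (j - p) else 0))"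
    using p0 by (intro sum.cong) auto
  also have "\<dots> = (m choose j) + (if p \<le> j then m choose (j - p) else 0)"
    by (simp add: sum.distrib)
  finally show ?thesis
    by (simp add: vandermonde add.commute)
qed

text \<open>Lucas' congruence for equal residues \<open>r\<close>: adding \<open>p\<close> to the
  top acts as Pascal's rule on \<open>m\<close> and \<open>n\<close>.\<close>

lemma binomial_same_residue_cong:
  assumes p: "prime p" and r: "r < p"
  shows "[(m * p + r) choose (n * p + r) = m choose n] (mod p)"
proof (induction m arbitrary: n)
  case 0
  show ?case using r by (cases n) (auto simp: binomial_eq_0)
next
  case (Suc m)
  have step: "[(Suc m * p + r) choose (n * p + r) = ((m * p + r) choose (n * p + r))
      + (if p \<le> n * p + r then (m * p + r) choose (n * p + r - p) else 0)] (mod p)"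
    using binomial_add_prime_cong[OF p, of "m * p + r" "n * p + r"] by (simp add: algebra_simps)
  show ?case
  proof (cases n)
    \<comment> \<open>Here \<open>r < p\<close> removes the second summand of
      \<open>step\<close>.\<close>
    case 0
    with step Suc.IH[of 0] r show ?thesis by (auto intro: cong_trans)
  next
    case (Suc n')
    have "[(Suc m * p + r) choose (n * p + r)
        = ((m * p + r) choose (n * p + r)) + ((m * p + r) choose (n' * p + r))] (mod p)"
      using step Suc by (simp add: algebra_simps)
    also have "[((m * p + r) choose (n * p + r)) + ((m * p + r) choose (n' * p + r))
        = (m choose n) + (m choose n')] (mod p)"
      by (intro cong_add Suc.IH)
    finally show ?thesis using Suc by (simp add: add.commute)
  qed
qed

section \<open>Averaged linear relations modulo \<open>p\<close>\<close>

text \<open>Both entries of the double-counting binomial have residue \<open>p - r\<close>, with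
  quotients \<open>a - 1 - k\<close> and \<open>b - 1 - k\<close>, so Lucas' congruence
  applies.\<close>

lemma sum_card_zero_sums_subsets_cong:
  assumes p: "prime p" and r: "0 < r" "r \<le> p" and I: "finite I" "card I = a * p - r" and b: "k < b" "b \<le> a"
  shows "[(\<Sum>L\<in>{L. L \<subseteq> I \<and> card L = b * p - r}. int (card (zero_sums p K w (k * p) L)))
    = int ((a - 1 - k) choose (b - 1 - k)) * int (card (zero_sums p K w (k * p) I))] (mod int p)"
proof -
  have less: "c * p - r - k * p = (c - 1 - k) * p + (p - r)" if "k < c" for c
  proof -
    from that obtain d where "c = Suc (k + d)" by (auto simp: less_iff_Suc_add)
    then show ?thesis using r by (simp add: algebra_simps)
  qed
  have le: "k * p \<le> b * p - r"
  proof -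
    have "Suc k * p \<le> b * p" using b by (intro mult_right_mono) auto
    then show ?thesis using r by simp
  qed
  have "[(card I - k * p) choose (b * p - r - k * p) = (a - 1 - k) choose (b - 1 - k)] (mod p)"
    unfolding I(2) less[OF b(1)] less[OF less_le_trans[OF b]]
    using r by (intro binomial_same_residue_cong p) simp
  then have "[((card I - k * p) choose (b * p - r - k * p)) * card (zero_sums p K w (k * p) I)
      = ((a - 1 - k) choose (b - 1 - k)) * card (zero_sums p K w (k * p) I)] (mod p)"
    by (rule cong_scalar_right)
  then show ?thesis
    unfolding sum_card_zero_sums_subsets[OF I(1) le, symmetric]
    by (simp flip: cong_int_iff)
qed

lemma weighted_alternating_zero_sums:
  assumes p: "prime p" "odd p" and r: "0 < r" "r \<le> p" and K: "finite K"
    and I: "finite I" "card I = a * p - r" and b: "b \<le> a"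
    and lower: "Suc (card K) * (p - 1) < b * p - r"
  shows "int p dvd (\<Sum>k<b. (-1) ^ k * int ((a - 1 - k) choose (b - 1 - k))
    * int (card (zero_sums p K w (k * p) I)))"
proof -
  let ?\<L> = "{L. L \<subseteq> I \<and> card L = b * p - r}"
  have "int p dvd (\<Sum>L\<in>?\<L>. \<Sum>k<b. (-1) ^ k * int (card (zero_sums p K w (k * p) L)))"
    using I r lower
    by (intro dvd_sum alternating_zero_sums p K) (auto intro: finite_subset)
  also have "(\<Sum>L\<in>?\<L>. \<Sum>k<b. (-1) ^ k * int (card (zero_sums p K w (k * p) L)))
      = (\<Sum>k<b. (-1) ^ k * (\<Sum>L\<in>?\<L>. int (card (zero_sums p K w (k * p) L))))"
    by (subst sum.swap) (simp add: sum_distrib_left)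
  finally have "int p dvd (\<Sum>k<b. (-1) ^ k * (\<Sum>L\<in>?\<L>. int (card (zero_sums p K w (k * p) L))))" .
  moreover have "[(\<Sum>k<b. (-1) ^ k * (\<Sum>L\<in>?\<L>. int (card (zero_sums p K w (k * p) L))))
      = (\<Sum>k<b. (-1) ^ k * (int ((a - 1 - k) choose (b - 1 - k))
      * int (card (zero_sums p K w (k * p) I))))] (mod int p)"
    using b by (intro cong_sum cong_mult cong_refl sum_card_zero_sums_subsets_cong p r I) auto
  ultimately show ?thesis by (simp add: cong_dvd_iff mult.assoc)
qed

text \<open>The counts are summed over all subsets of size \<open>4 * p - r\<close> in two ways:
  with weight \<open>(a - 3) choose 1\<close> by double counting, and as \<open>c\<close> times the
  number of subsets.\<close>

lemma zero_sums_2_of_constant: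
  assumes p: "prime p" and r: "0 < r" "r \<le> p" and I: "finite I" "card I = a * p - r" and a: "4 \<le> a"
    and c: "\<And>L. L \<subseteq> I \<Longrightarrow> card L = 4 * p - r \<Longrightarrow>
      [int (card (zero_sums p K w (2 * p) L)) = c] (mod int p)"
  shows "[int (a - 3) * int (card (zero_sums p K w (2 * p) I)) = int ((a - 1) choose 3) * c] (mod int p)"
proof -
  let ?\<L> = "{L. L \<subseteq> I \<and> card L = 4 * p - r}"
  have "[(\<Sum>L\<in>?\<L>. int (card (zero_sums p K w (2 * p) L)))
      = int (a - 3) * int (card (zero_sums p K w (2 * p) I))] (mod int p)"
    using sum_card_zero_sums_subsets_cong[OF p r I, of 2 4 K w] a by (simp add: numeral_3_eq_3)
  moreover have "[(\<Sum>L\<in>?\<L>. int (card (zero_sums p K w (2 * p) L))) = (\<Sum>L\<in>?\<L>. c)] (mod int p)"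
    using c by (intro cong_sum) auto
  moreover have "[(\<Sum>L\<in>?\<L>. c) = int ((a - 1) choose 3) * c] (mod int p)"
  proof -
    have less: "d * p - r = (d - 1) * p + (p - r)" if "4 \<le> d" for d
    proof -
      from that obtain e where "d = Suc e" by (cases d) auto
      then show ?thesis using r by simp
    qed
    have "[card I choose (4 * p - r) = (a - 1) choose (4 - 1)] (mod p)"
      unfolding I(2) less[OF a] less[OF order_refl]
      using r by (intro binomial_same_residue_cong p) simp
    then have "[int (card I choose (4 * p - r)) = int ((a - 1) choose 3)] (mod int p)"
      by (simp add: cong_int_iff)
    then show ?thesis
      using I by (simp add: n_subsets cong_scalar_right)
  qed
  ultimately show ?thesis
    by (meson cong_sym cong_trans)
qed

section \<open>Contradiction from the linear relations\<close>

lemma zero_sum_length_p: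
  fixes w :: "'k \<Rightarrow> 'a \<Rightarrow> int"
  assumes p: "prime p" "p > 7" and K: "finite K" "card K = 3"
    and J: "finite J" "card J = 7 * p - 3"
    and c: "\<And>I. I \<subseteq> J \<Longrightarrow> card I = 4 * p - 3 \<Longrightarrow>
      [int (card (zero_sums p K w (2 * p) I)) = c] (mod int p)"
  shows "zero_sums p K w p J \<noteq> {}"
proof
  assume none: "zero_sums p K w p J = {}"
  have odd: "odd p" using p prime_odd_nat by auto
  have prime_int: "prime (int p)" using p by simp
  define N where "N k I = int (card (zero_sums p K w (k * p) I))" for k I
  have N0: "N 0 I = 1" if "I \<subseteq> J" for I
  proof -
    have "zero_sums p K w 0 I = {{}}"
      using finite_subset[OF that J(1)] by (auto simp: zero_sums_def dest: finite_subset)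
    then show ?thesis by (simp add: N_def)
  qed
  have empty: "zero_sums p K w p I = {}" if "I \<subseteq> J" for I
    using none that by (auto simp: zero_sums_def)
  have N1: "N (Suc 0) I = 0" if "I \<subseteq> J" for I
    using empty[OF that] by (simp add: N_def)
  have eq: "int p dvd (\<Sum>k<b. (-1) ^ k * int ((a - 1 - k) choose (b - 1 - k)) * N k I)"
    if "I \<subseteq> J" "card I = a * p - 3" "4 \<le> b" "b \<le> a" for I a b
  proof -
    \<comment> \<open>The case \<open>b = 4\<close> is sharp: \<open>4 * p - 3\<close> is the least
      size above the degree \<open>4 * (p - 1)\<close>, whence the offset 3.\<close>
    have "4 * p \<le> b * p" using that(3) by simp
    then have "4 * (p - 1) < b * p - 3"
      using p(2) by linarith
    then have "Suc (card K) * (p - 1) < b * p - 3"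
      by (simp add: K(2))
    then show ?thesis
      unfolding N_def using that p finite_subset[OF that(1) J(1)]
      by (intro weighted_alternating_zero_sums odd K(1)) auto
  qed
  have N2: "int p dvd int (a - 3) * N 2 I - int ((a - 1) choose 3) * c"
    if "I \<subseteq> J" "card I = a * p - 3" "4 \<le> a" for I a
    unfolding N_def cong_iff_dvd_diff[symmetric]
    using that p finite_subset[OF that(1) J(1)] c
    by (intro zero_sums_2_of_constant[where r = 3]) auto
  \<comment> \<open>The constants from 1 to 7 are units modulo \<open>p\<close>.\<close>
  have not_dvd: "\<not> int p dvd n" if "0 < n" "n \<le> 7" for n
    using that p(2) by (intro zdvd_not_zless) auto
  have cancel: "int p dvd n" if "int p dvd m * n" "0 < m" "m \<le> 7" for m n
    using that not_dvd prime_int by (auto simp: prime_dvd_mult_iff)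
  have no_complement: "zero_sums p K w ((k - 1) * p) Z = {}"
    if "Z \<in> zero_sums p K w (k * p) J" "0 < k" for k Z
  proof (rule ccontr)
    assume "zero_sums p K w ((k - 1) * p) Z \<noteq> {}"
    then obtain S where S: "S \<in> zero_sums p K w ((k - 1) * p) Z" by blast
    have "k * p - (k - 1) * p = p" using that(2) by (cases k) auto
    moreover have "Z \<subseteq> J" using that(1) by (simp add: zero_sums_def)
    ultimately show False
      using zero_sums_diff[OF finite_subset[OF _ J(1)] that(1) S] empty by auto
  qed
  \<comment> \<open>Dropping three terms gives a size to which \<open>eq\<close> and
    \<open>N2\<close> apply.\<close>
  have subset: "\<exists>I\<subseteq>J. card I = k * p - 3 \<and> N (k - 1) I = 0"
    if "N k J \<noteq> 0" "0 < k" for k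
  proof -
    from that(1) obtain Z where Z: "Z \<in> zero_sums p K w (k * p) J"
      by (auto simp: N_def card_eq_0_iff)
    then have "k * p - 3 \<le> card Z"
      by (simp add: zero_sums_def)
    then obtain I where I: "I \<subseteq> Z" "card I = k * p - 3"
      by (rule obtain_subset_with_card_n)
    have "zero_sums p K w ((k - 1) * p) I = {}"
      using no_complement[OF Z that(2)] I(1) by (auto simp: zero_sums_def)
    then have "N (k - 1) I = 0"
      by (simp add: N_def)
    moreover have "I \<subseteq> J"
      using I Z by (auto simp: zero_sums_def)
    ultimately show ?thesis
      using I by blast
  qed
  note sums = N0 N1 lessThan_Suc numeral_eq_Suc binomial_eq_0
  have c4: "int p dvd c + 1" if "N 4 J \<noteq> 0"
  proof -
    from subset[OF that] obtain I where I: "I \<subseteq> J" "card I = 4 * p - 3" "N 3 I = 0" by auto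
    have "int p dvd 1 + N 2 I"
      using eq[OF I(1,2), of 4] I by (simp add: sums algebra_simps)
    moreover have "int p dvd N 2 I - c"
      using N2[OF I(1,2)] by simp
    ultimately have "int p dvd 1 + N 2 I - (N 2 I - c)"
      by (rule dvd_diff)
    then show ?thesis by (simp add: algebra_simps)
  qed
  have c6: "int p dvd 5 * c + 9" if "N 6 J \<noteq> 0"
  proof -
    from subset[OF that] obtain I where I: "I \<subseteq> J" "card I = 6 * p - 3" "N 5 I = 0" by auto
    \<comment> \<open>The coefficients are \<open>(5 - k) choose (b - 1 - k)\<close> up to sign;
      \<open>N 5 I = 0\<close> removes the top term for \<open>b = 6\<close>.\<close>
    have i4: "int p dvd 10 + 3 * N 2 I - N 3 I"
      using eq[OF I(1,2), of 4] I by (simp add: sums algebra_simps)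
    have i5: "int p dvd 5 + 3 * N 2 I - 2 * N 3 I + N 4 I"
      using eq[OF I(1,2), of 5] I by (simp add: sums algebra_simps)
    have i6: "int p dvd 1 + N 2 I - N 3 I + N 4 I"
      using eq[OF I(1,2), of 6] I by (simp add: sums algebra_simps)
    \<comment> \<open>The combination \<open>i6 - i5 + i4\<close> eliminates \<open>N 3 I\<close>
      and \<open>N 4 I\<close>.\<close>
    from dvd_add[OF dvd_diff[OF i6 i5] i4] have "int p dvd 6 + N 2 I"
      by (simp add: algebra_simps)
    then have "int p dvd 3 * (6 + N 2 I)"
      by (rule dvd_mult)
    moreover have "int p dvd 3 * N 2 I - 10 * c"
      using N2[OF I(1,2)] by (simp add: sums)
    ultimately have "int p dvd 3 * (6 + N 2 I) - (3 * N 2 I - 10 * c)"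
      by (rule dvd_diff)
    then have "int p dvd 2 * (5 * c + 9)"
      by (simp add: algebra_simps)
    then show ?thesis by (rule cancel) auto
  qed
  note J7 = eq[OF order_refl J(2)]
  \<comment> \<open>Now \<open>a = 7\<close>: the coefficients are
    \<open>(6 - k) choose (b - 1 - k)\<close> up to sign.\<close>
  have b4: "int p dvd 20 + 4 * N 2 J - N 3 J"
    using J7[of 4] by (simp add: sums algebra_simps)
  have b5: "int p dvd 15 + 6 * N 2 J - 3 * N 3 J + N 4 J"
    using J7[of 5] by (simp add: sums algebra_simps)
  have b6: "int p dvd 6 + 4 * N 2 J - 3 * N 3 J + 2 * N 4 J - N 5 J"
    using J7[of 6] by (simp add: sums algebra_simps)
  have b7: "int p dvd 1 + N 2 J - N 3 J + N 4 J - N 5 J + N 6 J"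
    using J7[of 7] by (simp add: sums algebra_simps)
  have "int p dvd 4 * (N 2 J - 5 * c)"
    using N2[OF order_refl J(2)] by (simp add: sums)
  then have N2J: "int p dvd N 2 J - 5 * c"
    by (rule cancel) auto
  \<comment> \<open>Here \<open>b5 - 3 * b4\<close> eliminates \<open>N 3 J\<close>, and
    \<open>N2J\<close> replaces \<open>N 2 J\<close> by \<open>5 * c\<close>.\<close>
  from dvd_add[OF dvd_diff[OF b5 dvd_mult[OF b4, of 3]] dvd_mult[OF N2J, of 6]]
  have N4J: "int p dvd N 4 J - 30 * c - 45"
    by (simp add: algebra_simps)
  \<comment> \<open>The alternating sum \<open>b7 - b6 + b5 - b4\<close> leaves only
    \<open>N 6 J - N 2 J - 10\<close>.\<close>
  from dvd_add[OF dvd_diff[OF dvd_add[OF dvd_diff[OF b7 b6] b5] b4] N2J]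
  have N6J: "int p dvd N 6 J - 5 * c - 10"
    by (simp add: algebra_simps)
  show False
  \<comment> \<open>Modulo \<open>p\<close>, \<open>N 6 J = 0\<close> forces \<open>c = -2\<close>,
    and otherwise \<open>5 * c = -9\<close>. Combined with the two cases for \<open>N 4 J\<close>,
    \<open>p\<close> would divide 15, 1, 9 or 4.\<close>
  proof (cases "N 6 J = 0")
    case True
    then have "N 6 J - 5 * c - 10 = - (5 * (c + 2))"
      by simp
    with N6J have "int p dvd 5 * (c + 2)"
      by (metis dvd_minus_iff)
    then have c2: "int p dvd c + 2" by (rule cancel) auto
    show False
    proof (cases "N 4 J = 0")
      case True
      from dvd_add[OF N4J dvd_mult[OF c2, of 30]] have "int p dvd 3 * 5"
        by (simp add: True algebra_simps)
      then have "int p dvd 5" by (rule cancel) auto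
      then show False using not_dvd[of 5] by simp
    next
      case False
      from dvd_diff[OF c2 c4[OF False]] show False using not_dvd[of 1] by simp
    qed
  next
    case False
    note c6 = c6[OF this]
    show False
    proof (cases "N 4 J = 0")
      case True
      from dvd_add[OF N4J dvd_mult[OF c6, of 6]] have "int p dvd 3 * 3"
        by (simp add: True algebra_simps)
      then have "int p dvd 3" by (rule cancel) auto
      then show False using not_dvd[of 3] by simp
    next
      case False
      from dvd_diff[OF c6 dvd_mult[OF c4[OF False], of 5]] show False
        using not_dvd[of 4] by simp
    qed
  qed
qed

section \<open>Translation to sequences in \<open>Zp3\<close>\<close>

theorem theorem1:
  fixes p :: nat and c :: int and J :: "(int \<times> int \<times> int) list"
  assumes "prime p" and "p > 7"
    and "set J \<subseteq> carrier (Zp3 p)"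
    and "length J = 7 * p - 3"
    and "\<And>I. I \<subseteq> {..<length J} \<Longrightarrow> card I = 4 * p - 3 \<Longrightarrow>
           [int (num_zero_sum p 2 J I) = c] (mod int p)"
  shows "\<exists>I \<subseteq> {..<length J}. card I = p \<and> seq_sum p J I = \<one>\<^bsub>Zp3 p\<^esub>"
proof -
  \<comment> \<open>List lookup indexes the coordinates by \<open>{..<3}\<close>, a set of
    cardinality 3 as \<open>zero_sum_length_p\<close> requires.\<close>
  define w where "w = (\<lambda>k i. [fst (J ! i), fst (snd (J ! i)), snd (snd (J ! i))] ! k)"
  have zero_iff: "seq_sum p J S = \<one>\<^bsub>Zp3 p\<^esub> \<longleftrightarrow> (\<forall>k\<in>{..<3}. int p dvd (\<Sum>i\<in>S. w k i))"
    if "S \<subseteq> {..<length J}" for S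
    unfolding seq_sum_eq[OF assms(3) that]
    by (auto simp: Zp3_def w_def numeral_3_eq_3 lessThan_Suc dvd_eq_mod_eq_0)
  have count: "num_zero_sum p 2 J I = card (zero_sums p {..<3} w (2 * p) I)"
    if "I \<subseteq> {..<length J}" for I
    unfolding num_zero_sum_def zero_sums_def
    using that zero_iff by (intro arg_cong[where f = card] Collect_cong) blast
  have "zero_sums p {..<3} w p {..<length J} \<noteq> {}"
    using assms count by (intro zero_sum_length_p[where c = c]) auto
  then show ?thesis
    using zero_iff by (auto simp: zero_sums_def)
qed

end
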